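(* Let $n\ge1$. For each $\epsilon>0$, the function $(X,Y)\mapsto\lambda_{\max}(X,Y+\epsilon I)$ from $\mathbb{S}^n_{\succeq0}\times\mathbb{S}^n_{\succeq0}$ to $\mathbb{R}$ is continuous, and as $\epsilon\to0$ (with $\epsilon>0$) these functions epi-converge to the function $\lambda_{\max}(\cdot,\cdot):\mathbb{S}^n_{\succeq0}\times\mathbb{S}^n_{\succeq0}\to(-\infty,\infty]$.
   Context: $\mathbb{S}^n$ is the space of real symmetric $n\times n$ matrices and $\mathbb{S}^n_{\succeq0}$ the subset of positive semidefinite ones; $\mathrm{Ker}\,Y=\{v\in\mathbb{R}^n\mid Yv=0\}$. The maximum generalized eigenvalue function is defined for $X,Y\in\mathbb{S}^n_{\succeq0}$ by $$\lambda_{\max}(X,Y):=\begin{cases}\displaystyle\sup_{v\notin\mathrm{Ker}\,Y}\frac{v^\top Xv}{v^\top Yv} & (Y\neq0),\\ \infty & (X\neq0,\ Y=0),\\ 0 & (X=Y=0).\end{cases}$$ Epi-convergence: for $f:E\to(-\infty,\infty]$ on a finite-dimensional Euclidean space $E$, $\mathrm{epi} f=\{(x,\alpha)\in E\times\mathbb{R}\mid f(x)\le\alpha\}$. A sequence $f^k$ epi-converges to $f$ if $\mathrm{epi} f^k$ converges to $\mathrm{epi} f$ in the Painlevé–Kuratowski sense, i.e. both the outer limit $\{z\mid\liminf_{k\to\infty} d(z,\mathrm{epi} f^k)=0\}$ and the inner limit $\{z\mid\limsup_{k\to\infty} d(z,\mathrm{epi} f^k)=0\}$ equal $\mathrm{epi}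 f$, where $d(z,A)=\inf_{y\in A}d(z,y)$. A family indexed by $\epsilon>0$ epi-converges as $\epsilon\to0$ if it does so along every sequence $\epsilon_k\to0$ with $\epsilon_k>0$. Functions defined only on a subset of $E$ are extended by the value $\infty$ outside that subset; here $E=\mathbb{S}^n\times\mathbb{S}^n$. *)

theory Defs
  imports "HOL-Analysis.Analysis"
begin

definition sym_mats :: "(real^'n^'n) set" where
  "sym_mats = {A. transpose A = A}"

definition psd_mats :: "(real^'n^'n) set" where
  "psd_mats = {A \<in> sym_mats. \<forall>v. 0 \<le> v \<bullet> (A *v v)}"

definition Ker :: "real^'n^'n \<Rightarrow> (real^'n) set" where
  "Ker Y = {v. Y *v v = 0}"

text \<open>Intended for positive semidefinite arguments only. The supremum is taken in \<^typ>\<open>ereal\<close>;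
  it ranges over a nonempty set, since \<open>Ker Y \<noteq> UNIV\<close> when \<open>Y \<noteq> 0\<close>.\<close>

definition lambda_max :: "real^'n^'n \<Rightarrow> real^'n^'n \<Rightarrow> ereal" where
  "lambda_max X Y =
     (if Y \<noteq> 0 then (SUP v\<in>- Ker Y. ereal ((v \<bullet> (X *v v)) / (v \<bullet> (Y *v v))))
      else if X \<noteq> 0 then \<infinity>
      else 0)"

text \<open>Extended-real-valued, so that the distance to the empty set is \<open>\<infinity>\<close>; the library's
  \<^const>\<open>infdist\<close> is \<open>0\<close> there.\<close>

definition dist_to_set :: "'a::metric_space \<Rightarrow> 'a set \<Rightarrow> ereal" where
  "dist_to_set z A = (INF y\<in>A. ereal (dist z y))"

text \<open>The ambient space \<open>E\<close> of a function is a set (such as a linear subspace) inside a type;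
  limits of sets are taken relative to an ambient set \<open>S\<close>.\<close>

definition outer_limit :: "'a::metric_space set \<Rightarrow> (nat \<Rightarrow> 'a set) \<Rightarrow> 'a set" where
  "outer_limit S A = {z \<in> S. liminf (\<lambda>k. dist_to_set z (A k)) = 0}"

definition inner_limit :: "'a::metric_space set \<Rightarrow> (nat \<Rightarrow> 'a set) \<Rightarrow> 'a set" where
  "inner_limit S A = {z \<in> S. limsup (\<lambda>k. dist_to_set z (A k)) = 0}"

definition epi :: "'a set \<Rightarrow> ('a \<Rightarrow> ereal) \<Rightarrow> ('a \<times> real) set" where
  "epi E f = {(x, \<alpha>). x \<in> E \<and> f x \<le> ereal \<alpha>}"

definition epi_converges ::
    "'a::metric_space set \<Rightarrow> (nat \<Rightarrow> 'a \<Rightarrow> ereal) \<Rightarrow> ('a \<Rightarrow> ereal) \<Rightarrow> bool" where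
  "epi_converges E F f \<longleftrightarrow>
     outer_limit (E \<times> UNIV) (\<lambda>k. epi E (F k)) = epi E f \<and>
     inner_limit (E \<times> UNIV) (\<lambda>k. epi E (F k)) = epi E f"

definition epi_converges_at_right_0 ::
    "'a::metric_space set \<Rightarrow> (real \<Rightarrow> 'a \<Rightarrow> ereal) \<Rightarrow> ('a \<Rightarrow> ereal) \<Rightarrow> bool" where
  "epi_converges_at_right_0 E F f \<longleftrightarrow>
     (\<forall>e. (\<forall>k. 0 < e k) \<longrightarrow> e \<longlonglongrightarrow> 0 \<longrightarrow> epi_converges E (\<lambda>k. F (e k)) f)"

definition extend_infty :: "'a set \<Rightarrow> ('a \<Rightarrow> ereal) \<Rightarrow> 'a \<Rightarrow> ereal" where
  "extend_infty D f x = (if x \<in> D then f x else \<infinity>)"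

end

theory Submission
  imports Defs
begin

text \<open>The epigraph of \<open>\<lambda>\<^sub>m\<^sub>a\<^sub>x\<close> over pairs of positive semidefinite matrices is cut out by the
  conditions \<open>0 \<le> \<alpha>\<close> and \<open>v \<bullet> X v \<le> \<alpha> (v \<bullet> Y v)\<close> for all \<open>v\<close>. These
  are preserved when \<open>Y\<close> is replaced by \<open>Y + \<epsilon> I\<close>, so the epigraph of the limit lies in each
  of the perturbed ones, and they are closed jointly in \<open>(X, Y, \<alpha>, \<epsilon>)\<close>, so every outer limit
  point lies in the epigraph of the limit. For fixed \<open>\<epsilon>\<close>, the same conditions together with
  \<open>v \<bullet> (Y + \<epsilon> I) v \<ge> \<epsilon> (v \<bullet> v)\<close> give a local Lipschitz estimate.\<close>

section \<open>Norm bounds and limits for matrix-vector products and quadratic forms\<close>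

lemma norm_matrix_vector_mult_le:
  fixes A :: "real^'n^'m"
  shows "norm (A *v v) \<le> norm A * norm v"
proof -
  \<comment> \<open>The norm on matrices is the L2 norm of the row norms, i.e. the Frobenius norm,
    so Cauchy-Schwarz in each row suffices.\<close>
  have "norm (A *v v) = L2_set (\<lambda>i. norm (A $ i \<bullet> v)) UNIV"
    by (simp add: norm_vec_def matrix_vector_mul_component)
  also have "\<dots> \<le> L2_set (\<lambda>i. norm (A $ i) * norm v) UNIV"
    by (intro L2_set_mono) (auto simp: Cauchy_Schwarz_ineq2)
  also have "\<dots> = norm A * norm v"
    by (simp add: norm_vec_def[of A] L2_set_left_distrib)
  finally show ?thesis .
qed

lemma abs_quadratic_form_le:
  fixes A :: "real^'n^'n"
  shows "\<bar>v \<bullet> (A *v v)\<bar> \<le> norm A * (v \<bullet> v)"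
proof -
  have "\<bar>v \<bullet> (A *v v)\<bar> \<le> norm v * norm (A *v v)"
    by (rule Cauchy_Schwarz_ineq2)
  also have "\<dots> \<le> norm v * (norm A * norm v)"
    by (intro mult_left_mono norm_matrix_vector_mult_le) auto
  finally show ?thesis
    by (simp add: dot_square_norm power2_eq_square algebra_simps)
qed

lemma tendsto_matrix_vector_mult:
  fixes A :: "'a \<Rightarrow> real^'n^'m"
  assumes "(A \<longlongrightarrow> L) F"
  shows "((\<lambda>x. A x *v v) \<longlongrightarrow> L *v v) F"
  unfolding matrix_vector_mult_def
  by (intro tendsto_vec_lambda tendsto_intros assms)

section \<open>Quadratic forms of symmetric and positive semidefinite matrices\<close>

lemma sym_mats_inner:
  assumes "A \<in> sym_mats"
  shows "v \<bullet> (A *v w) = w \<bullet> (A *v v)"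
  using assms
  by (metis (mono_tags) dot_lmul_matrix inner_commute mem_Collect_eq sym_mats_def
      transpose_matrix_vector)

lemma sym_mats_quadratic_form_add:
  assumes "A \<in> sym_mats"
  shows "(v + t *\<^sub>R w) \<bullet> (A *v (v + t *\<^sub>R w)) =
    v \<bullet> (A *v v) + 2 * t * (w \<bullet> (A *v v)) + t\<^sup>2 * (w \<bullet> (A *v w))"
  using sym_mats_inner[OF assms, of v w]
  by (simp add: matrix_vector_right_distrib matrix_vector_mult_scaleR inner_add_left
      inner_add_right power2_eq_square algebra_simps)

lemma psd_matsD:
  assumes "A \<in> psd_mats"
  shows "A \<in> sym_mats" and "0 \<le> v \<bullet> (A *v v)"
  using assms by (auto simp: psd_mats_def)

text \<open>If \<open>A *v v\<close> were nonzero, moving from \<open>v\<close> a little against the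
  direction \<open>w = A *v v\<close> would make the form negative: its linear term
  \<open>2 * t * s\<close> dominates the quadratic one for small negative \<open>t\<close>.\<close>

lemma psd_mats_quadratic_form_eq_0:
  assumes A: "A \<in> psd_mats" and v: "v \<bullet> (A *v v) = 0"
  shows "A *v v = 0"
proof (rule ccontr)
  assume neq: "A *v v \<noteq> 0"
  define w where "w = A *v v"
  define s where "s = w \<bullet> w"
  define q where "q = w \<bullet> (A *v w)"
  have s: "s > 0" using neq by (simp add: s_def w_def)
  have q: "q \<ge> 0" unfolding q_def by (rule psd_matsD(2)[OF A])
  \<comment> \<open>The minimizer would be \<open>- s / q\<close>, but \<open>q\<close> may vanish.
    With \<open>q + 1\<close> the division is safe, and the form becomes exactly
    \<open>t * s - t\<^sup>2\<close>.\<close>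
  define t where "t = - s / (q + 1)"
  have t: "t * (q + 1) = - s" using q by (simp add: t_def)
  have "0 \<le> (v + t *\<^sub>R w) \<bullet> (A *v (v + t *\<^sub>R w))"
    by (rule psd_matsD(2)[OF A])
  also have "\<dots> = 2 * t * s + t\<^sup>2 * q"
    using sym_mats_quadratic_form_add[OF psd_matsD(1)[OF A], of v t w] v
    by (simp add: s_def q_def w_def)
  also have "\<dots> = t * s - t\<^sup>2"
  proof -
    have "t\<^sup>2 * q = t * (t * (q + 1)) - t\<^sup>2" by (simp add: power2_eq_square algebra_simps)
    then show ?thesis using t by simp
  qed
  also have "\<dots> < 0"
  proof -
    have "t < 0" using s q by (simp add: t_def)
    then have "t * s < 0" using s by (simp add: mult_neg_pos)
    then show ?thesis using zero_le_power2[of t] by linarith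
  qed
  finally show False by simp
qed

text \<open>This makes every denominator in the supremum defining \<open>lambda_max\<close>
  positive.\<close>

lemma psd_mats_quadratic_form_pos:
  assumes "A \<in> psd_mats" and "v \<notin> Ker A"
  shows "0 < v \<bullet> (A *v v)"
  using assms psd_mats_quadratic_form_eq_0[of A v] psd_matsD(2)[of A v]
  by (auto simp: Ker_def less_le)

lemma Ker_neq_UNIV:
  assumes "A \<noteq> 0"
  obtains v where "v \<notin> Ker A"
proof -
  have "\<exists>v. A *v v \<noteq> 0 *v v" using assms by (auto simp: matrix_eq)
  then show ?thesis using that by (auto simp: Ker_def)
qed

section \<open>The epigraph of \<open>lambda_max\<close> described by inequalities between
  forms\<close>

lemma lambda_max_nonneg:
  assumes X: "X \<in> psd_mats" and Y: "Y \<in> psd_mats"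
  shows "0 \<le> lambda_max X Y"
proof (cases "Y = 0")
  case False
  then obtain v where v: "v \<notin> Ker Y" by (rule Ker_neq_UNIV)
  have "0 \<le> ereal ((v \<bullet> (X *v v)) / (v \<bullet> (Y *v v)))"
    using psd_matsD(2)[OF X] psd_matsD(2)[OF Y] by simp
  also have "\<dots> \<le> lambda_max X Y"
    using False v by (auto simp: lambda_max_def intro!: SUP_upper)
  finally show ?thesis .
qed (auto simp: lambda_max_def)

text \<open>One condition without quotients covers all three cases of the definition. For
  \<open>Y = 0\<close> the inequalities force \<open>X = 0\<close>, and then
  \<open>0 \<le> \<alpha>\<close> is what remains. For \<open>Y \<noteq> 0\<close> the denominators
  are cleared outside the kernel, and the inequality extends to \<open>Ker Y\<close> by
  continuity.\<close>

lemma lambda_max_le_iff: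
  assumes X: "X \<in> psd_mats" and Y: "Y \<in> psd_mats"
  shows "lambda_max X Y \<le> ereal \<alpha> \<longleftrightarrow>
    0 \<le> \<alpha> \<and> (\<forall>v. v \<bullet> (X *v v) \<le> \<alpha> * (v \<bullet> (Y *v v)))"
proof (cases "Y = 0")
  case True
  have "X = 0" if "\<forall>v. v \<bullet> (X *v v) \<le> 0"
  proof (rule ccontr)
    assume "X \<noteq> 0"
    then obtain v where "v \<notin> Ker X" by (rule Ker_neq_UNIV)
    then show False using psd_mats_quadratic_form_pos[OF X] that by (metis not_le)
  qed
  then show ?thesis using True by (auto simp: lambda_max_def zero_ereal_def[symmetric])
next
  case False
  have "lambda_max X Y \<le> ereal \<alpha> \<longleftrightarrow>
      (\<forall>v. v \<notin> Ker Y \<longrightarrow> (v \<bullet> (X *v v)) / (v \<bullet> (Y *v v)) \<le> \<alpha>)"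
    using False by (auto simp: lambda_max_def SUP_le_iff)
  also have "\<dots> \<longleftrightarrow> (\<forall>v. v \<notin> Ker Y \<longrightarrow> v \<bullet> (X *v v) \<le> \<alpha> * (v \<bullet> (Y *v v)))"
    using psd_mats_quadratic_form_pos[OF Y] by (simp add: pos_divide_le_eq)
  finally have iff: "lambda_max X Y \<le> ereal \<alpha> \<longleftrightarrow>
      (\<forall>v. v \<notin> Ker Y \<longrightarrow> v \<bullet> (X *v v) \<le> \<alpha> * (v \<bullet> (Y *v v)))" .
  show ?thesis
  proof
    assume le: "lambda_max X Y \<le> ereal \<alpha>"
    then have bound: "v \<bullet> (X *v v) \<le> \<alpha> * (v \<bullet> (Y *v v))" if "v \<notin> Ker Y" for v
      using iff that by blast
    have "0 \<le> ereal \<alpha>" using lambda_max_nonneg[OF X Y] le by (rule order_trans)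
    moreover have "v \<bullet> (X *v v) \<le> \<alpha> * (v \<bullet> (Y *v v))" for v
    proof (cases "v \<in> Ker Y")
      case True
      obtain w where w: "w \<notin> Ker Y" using False by (rule Ker_neq_UNIV)
      have Yv: "Y *v v = 0" using True by (simp add: Ker_def)
      \<comment> \<open>A kernel vector is approximated by the vectors \<open>v + t w\<close> outside the kernel.\<close>
      have "v \<bullet> (X *v v) + 2 * t * (w \<bullet> (X *v v)) + t\<^sup>2 * (w \<bullet> (X *v w))
          \<le> \<alpha> * (t\<^sup>2 * (w \<bullet> (Y *v w)))" if "t > 0" for t
      proof -
        have "v + t *\<^sub>R w \<notin> Ker Y"
          using w Yv that
          by (simp add: Ker_def matrix_vector_right_distrib matrix_vector_mult_scaleR)
        from bound[OF this] show ?thesis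
          using Yv by (simp add: sym_mats_quadratic_form_add psd_matsD(1) X Y)
      qed
      then have ev: "\<forall>\<^sub>F t in at_right 0.
          v \<bullet> (X *v v) + 2 * t * (w \<bullet> (X *v v)) + t\<^sup>2 * (w \<bullet> (X *v w))
          \<le> \<alpha> * (t\<^sup>2 * (w \<bullet> (Y *v w)))"
        by (simp add: eventually_at_right_less eventually_mono[OF eventually_at_right_less])
      \<comment> \<open>The limit for t tending to 0 from the right; the zero terms stay
        unsimplified so that both sides have the shape produced by
        \<open>tendsto_intros\<close>.\<close>
      have "v \<bullet> (X *v v) + 2 * 0 * (w \<bullet> (X *v v)) + 0\<^sup>2 * (w \<bullet> (X *v w))
          \<le> \<alpha> * (0\<^sup>2 * (w \<bullet> (Y *v w)))"
        by (rule tendsto_le[OF trivial_limit_at_right_real _ _ ev]) (intro tendsto_intros)+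
      then show ?thesis using Yv by simp
    qed (rule bound)
    ultimately show "0 \<le> \<alpha> \<and> (\<forall>v. v \<bullet> (X *v v) \<le> \<alpha> * (v \<bullet> (Y *v v)))" by simp
  qed (use iff in blast)
qed

section \<open>The perturbed function: finiteness and continuity\<close>

lemma quadratic_form_add_mat:
  fixes Y :: "real^'n^'n"
  shows "v \<bullet> ((Y + \<epsilon> *\<^sub>R mat 1) *v v) = v \<bullet> (Y *v v) + \<epsilon> * (v \<bullet> v)"
  by (simp add: matrix_vector_mult_add_rdistrib scaleR_matrix_vector_assoc[symmetric]
      inner_add_right)

lemma psd_mats_add_mat:
  fixes Y :: "real^'n^'n"
  assumes "Y \<in> psd_mats" and "0 \<le> \<epsilon>"
  shows "Y + \<epsilon> *\<^sub>R mat 1 \<in> psd_mats"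
proof -
  have "transpose (Y + \<epsilon> *\<^sub>R mat 1) = Y + \<epsilon> *\<^sub>R mat 1"
    using psd_matsD(1)[OF assms(1)]
    by (auto simp: sym_mats_def transpose_def mat_def vec_eq_iff)
  then show ?thesis
    using assms psd_matsD(2)[OF assms(1)]
    by (simp add: psd_mats_def sym_mats_def quadratic_form_add_mat)
qed

lemma lambda_max_perturbed_le_iff:
  fixes X Y :: "real^'n^'n"
  assumes "X \<in> psd_mats" and "Y \<in> psd_mats" and "0 \<le> \<epsilon>"
  shows "lambda_max X (Y + \<epsilon> *\<^sub>R mat 1) \<le> ereal \<alpha> \<longleftrightarrow>
    0 \<le> \<alpha> \<and> (\<forall>v. v \<bullet> (X *v v) \<le> \<alpha> * (v \<bullet> (Y *v v) + \<epsilon> * (v \<bullet> v)))"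
  using assms by (simp add: lambda_max_le_iff psd_mats_add_mat quadratic_form_add_mat)

text \<open>The form of \<open>X\<close> is at most \<open>norm X * (v \<bullet> v)\<close>, while
  the perturbed form of \<open>Y\<close> is at least \<open>\<epsilon> * (v \<bullet> v)\<close>.
  The bound also controls the Lipschitz estimate below.\<close>

lemma lambda_max_perturbed_le_norm:
  fixes X Y :: "real^'n^'n"
  assumes X: "X \<in> psd_mats" and Y: "Y \<in> psd_mats" and e: "0 < \<epsilon>"
  shows "lambda_max X (Y + \<epsilon> *\<^sub>R mat 1) \<le> ereal (norm X / \<epsilon>)"
proof -
  have "v \<bullet> (X *v v) \<le> norm X / \<epsilon> * (v \<bullet> (Y *v v) + \<epsilon> * (v \<bullet> v))" for v
  proof -
    have "v \<bullet> (X *v v) \<le> norm X / \<epsilon> * (\<epsilon> * (v \<bullet> v))"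
      using abs_quadratic_form_le[of v X] e by simp
    also have "\<dots> \<le> norm X / \<epsilon> * (v \<bullet> (Y *v v) + \<epsilon> * (v \<bullet> v))"
      using psd_matsD(2)[OF Y] e by (intro mult_left_mono) auto
    finally show ?thesis .
  qed
  then show ?thesis using e by (simp add: lambda_max_perturbed_le_iff[OF X Y])
qed

text \<open>Since \<open>real_of_ereal\<close> sends infinite values to 0, continuity of the
  real-valued version is meaningful only together with this.\<close>

lemma lambda_max_perturbed_finite:
  fixes X Y :: "real^'n^'n"
  assumes "X \<in> psd_mats" and "Y \<in> psd_mats" and "0 < \<epsilon>"
  shows "\<bar>lambda_max X (Y + \<epsilon> *\<^sub>R mat 1)\<bar> \<noteq> \<infinity>"
  using lambda_max_perturbed_le_norm[OF assms]
    lambda_max_nonneg[OF assms(1) psd_mats_add_mat[OF assms(2) less_imp_le[OF assms(3)]]]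
  by auto

text \<open>The value \<alpha> at \<open>(X, Y)\<close> satisfies the form inequalities there.
  Passing to \<open>(X', Y')\<close> costs at most a multiple of \<open>v \<bullet> v\<close>, which
  is absorbed by raising \<alpha>, because the perturbed form of \<open>Y'\<close> is at least
  \<open>\<epsilon> * (v \<bullet> v)\<close>.\<close>

lemma lambda_max_perturbed_lipschitz:
  fixes X Y X' Y' :: "real^'n^'n"
  assumes X: "X \<in> psd_mats" and Y: "Y \<in> psd_mats"
    and X': "X' \<in> psd_mats" and Y': "Y' \<in> psd_mats" and e: "0 < \<epsilon>"
  defines "g \<equiv> \<lambda>X Y. real_of_ereal (lambda_max X (Y + \<epsilon> *\<^sub>R mat 1 :: real^'n^'n))"
  shows "g X' Y' \<le> g X Y + (norm (X' - X) + norm X / \<epsilon> * norm (Y' - Y)) / \<epsilon>"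
proof -
  have g: "ereal (g A B) = lambda_max A (B + \<epsilon> *\<^sub>R mat 1)"
    if "A \<in> psd_mats" "B \<in> psd_mats" for A B
    using lambda_max_perturbed_finite[OF that e] by (simp add: g_def ereal_real')
  define \<alpha> where "\<alpha> = g X Y"
  have "lambda_max X (Y + \<epsilon> *\<^sub>R mat 1) \<le> ereal \<alpha>" by (simp add: \<alpha>_def g X Y)
  then have \<alpha>0: "0 \<le> \<alpha>"
    and \<alpha>: "\<And>v. v \<bullet> (X *v v) \<le> \<alpha> * (v \<bullet> (Y *v v) + \<epsilon> * (v \<bullet> v))"
    using e by (auto simp: lambda_max_perturbed_le_iff[OF X Y])
  have "ereal \<alpha> \<le> ereal (norm X / \<epsilon>)"
    unfolding \<alpha>_def g[OF X Y] by (rule lambda_max_perturbed_le_norm[OF X Y e])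
  then have \<alpha>_le: "\<alpha> \<le> norm X / \<epsilon>" by simp
  \<comment> \<open>The first summand pays for replacing \<open>X\<close>. The second pays for
    replacing \<open>Y\<close>, whose form enters with the factor \<alpha>, bounded by
    \<open>norm X / \<epsilon>\<close>.\<close>
  define c where "c = norm (X' - X) + norm X / \<epsilon> * norm (Y' - Y)"
  have c: "c \<ge> 0" using e by (simp add: c_def)
  have "v \<bullet> (X' *v v) \<le> (\<alpha> + c / \<epsilon>) * (v \<bullet> (Y' *v v) + \<epsilon> * (v \<bullet> v))" for v
  proof -
    have "v \<bullet> (X' *v v) = v \<bullet> (X *v v) + v \<bullet> ((X' - X) *v v)"
      by (simp add: matrix_vector_mult_diff_rdistrib inner_diff_right)
    also have "\<dots> \<le> \<alpha> * (v \<bullet> (Y *v v) + \<epsilon> * (v \<bullet> v)) + norm (X' - X) * (v \<bullet> v)"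
      using \<alpha>[of v] abs_quadratic_form_le[of v "X' - X"] by linarith
    also have "v \<bullet> (Y *v v) = v \<bullet> (Y' *v v) - v \<bullet> ((Y' - Y) *v v)"
      by (simp add: matrix_vector_mult_diff_rdistrib inner_diff_right)
    also have "\<alpha> * (v \<bullet> (Y' *v v) - v \<bullet> ((Y' - Y) *v v) + \<epsilon> * (v \<bullet> v)) + norm (X' - X) * (v \<bullet> v)
        = \<alpha> * (v \<bullet> (Y' *v v) + \<epsilon> * (v \<bullet> v)) + \<alpha> * (- (v \<bullet> ((Y' - Y) *v v)))
          + norm (X' - X) * (v \<bullet> v)"
      by (simp add: algebra_simps)
    also have "\<alpha> * (- (v \<bullet> ((Y' - Y) *v v))) \<le> norm X / \<epsilon> * (norm (Y' - Y) * (v \<bullet> v))"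
    proof -
      have "\<alpha> * (- (v \<bullet> ((Y' - Y) *v v))) \<le> \<alpha> * (norm (Y' - Y) * (v \<bullet> v))"
        using \<alpha>0 abs_quadratic_form_le[of v "Y' - Y"] by (intro mult_left_mono) linarith+
      also have "\<dots> \<le> norm X / \<epsilon> * (norm (Y' - Y) * (v \<bullet> v))"
        using \<alpha>_le by (intro mult_right_mono) auto
      finally show ?thesis .
    qed
    also have "\<alpha> * (v \<bullet> (Y' *v v) + \<epsilon> * (v \<bullet> v)) + norm X / \<epsilon> * (norm (Y' - Y) * (v \<bullet> v))
          + norm (X' - X) * (v \<bullet> v)
        = \<alpha> * (v \<bullet> (Y' *v v) + \<epsilon> * (v \<bullet> v)) + c / \<epsilon> * (\<epsilon> * (v \<bullet> v))"
      using e by (simp add: c_def field_simps)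
    also have "c / \<epsilon> * (\<epsilon> * (v \<bullet> v)) \<le> c / \<epsilon> * (v \<bullet> (Y' *v v) + \<epsilon> * (v \<bullet> v))"
      using c e psd_matsD(2)[OF Y', of v] by (intro mult_left_mono) auto
    finally show ?thesis by (simp add: algebra_simps)
  qed
  then have "lambda_max X' (Y' + \<epsilon> *\<^sub>R mat 1) \<le> ereal (\<alpha> + c / \<epsilon>)"
    using \<alpha>0 c e by (simp add: lambda_max_perturbed_le_iff[OF X' Y'])
  then have "ereal (g X' Y') \<le> ereal (\<alpha> + c / \<epsilon>)" by (simp add: g X' Y')
  then show ?thesis by (simp add: \<alpha>_def c_def)
qed

lemma continuous_on_lambda_max_perturbed:
  assumes e: "0 < \<epsilon>"
  shows "continuous_on (psd_mats \<times> psd_mats)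
    (\<lambda>(X, Y). real_of_ereal (lambda_max X (Y + \<epsilon> *\<^sub>R mat 1 :: real^'n^'n)))"
  unfolding continuous_on_def
proof (rule ballI)
  fix z :: "(real^'n^'n) \<times> (real^'n^'n)"
  assume z: "z \<in> psd_mats \<times> psd_mats"
  let ?F = "at z within psd_mats \<times> psd_mats"
  let ?g = "\<lambda>(X, Y). real_of_ereal (lambda_max X (Y + \<epsilon> *\<^sub>R mat 1 :: real^'n^'n))"
  \<comment> \<open>The one-sided estimate is used in both directions, with factor
    \<open>norm X / \<epsilon>\<close> or \<open>norm X' / \<epsilon>\<close>; their sum in
    \<open>h\<close> dominates both, and \<open>h\<close> still tends to 0 at
    \<open>z\<close>.\<close>
  define h :: "(real^'n^'n) \<times> (real^'n^'n) \<Rightarrow> real" where "h = (\<lambda>w. (norm (fst w - fst z)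
    + (norm (fst z) / \<epsilon> + norm (fst w) / \<epsilon>) * norm (snd w - snd z)) / \<epsilon>)"
  have "(h \<longlongrightarrow> (norm (fst z - fst z)
      + (norm (fst z) / \<epsilon> + norm (fst z) / \<epsilon>) * norm (snd z - snd z)) / \<epsilon>) ?F"
    unfolding h_def using e by (intro tendsto_intros) auto
  then have h: "(h \<longlongrightarrow> 0) ?F" by simp
  have "norm (?g w - ?g z) \<le> h w" if w: "w \<in> psd_mats \<times> psd_mats" for w
  proof -
    obtain X Y X' Y' where eqs: "z = (X, Y)" "w = (X', Y')" by (metis surj_pair)
    have mem: "X \<in> psd_mats" "Y \<in> psd_mats" "X' \<in> psd_mats" "Y' \<in> psd_mats"
      using z w by (auto simp: eqs)
    have "?g w - ?g z \<le> (norm (X' - X) + norm X / \<epsilon> * norm (Y' - Y)) / \<epsilon>"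
      using lambda_max_perturbed_lipschitz[OF mem e] by (simp add: eqs)
    also have "\<dots> \<le> h w"
      unfolding h_def eqs fst_conv snd_conv
      using e by (intro divide_right_mono add_left_mono mult_right_mono) auto
    finally have 1: "?g w - ?g z \<le> h w" .
    have "?g z - ?g w \<le> (norm (X' - X) + norm X' / \<epsilon> * norm (Y' - Y)) / \<epsilon>"
      using lambda_max_perturbed_lipschitz[OF mem(3,4,1,2) e]
      by (simp add: eqs norm_minus_commute)
    also have "\<dots> \<le> h w"
      unfolding h_def eqs fst_conv snd_conv
      using e by (intro divide_right_mono add_left_mono mult_right_mono) auto
    finally show ?thesis using 1 by (simp add: abs_le_iff)
  qed
  then have "\<forall>\<^sub>F w in ?F. norm (?g w - ?g z) \<le> h w"
    by (auto simp: eventually_at_filter)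
  from Lim_null_comparison[OF this h] show "(?g \<longlongrightarrow> ?g z) ?F"
    by (rule LIM_zero_cancel)
qed

section \<open>Inner and outer limits of sets\<close>

lemma dist_to_set_nonneg: "0 \<le> dist_to_set z A"
  by (auto simp: dist_to_set_def intro!: INF_greatest)

lemma dist_to_set_eq_0:
  assumes "z \<in> A"
  shows "dist_to_set z A = 0"
proof (rule antisym)
  have "dist_to_set z A \<le> ereal (dist z z)"
    unfolding dist_to_set_def using assms by (rule INF_lower)
  then show "dist_to_set z A \<le> 0" by (simp add: zero_ereal_def)
qed (rule dist_to_set_nonneg)

text \<open>This reduces epi-convergence to two inclusions: the epigraph in the inner limit, and the
  outer limit in the epigraph.\<close>

lemma inner_limit_subset_outer_limit: "inner_limit S A \<subseteq> outer_limit S A"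
proof
  fix z assume z: "z \<in> inner_limit S A"
  have "liminf (\<lambda>k. dist_to_set z (A k)) \<le> limsup (\<lambda>k. dist_to_set z (A k))"
    by (rule Liminf_le_Limsup) simp
  moreover have "0 \<le> liminf (\<lambda>k. dist_to_set z (A k))"
    by (rule Liminf_bounded) (simp add: dist_to_set_nonneg)
  ultimately show "z \<in> outer_limit S A"
    using z by (auto simp: inner_limit_def outer_limit_def)
qed

text \<open>Each point of \<open>B\<close> serves as its own constant recovery sequence.\<close>

lemma subset_inner_limit:
  assumes "B \<subseteq> S" and "\<And>k. B \<subseteq> A k"
  shows "B \<subseteq> inner_limit S A"
proof
  fix z assume z: "z \<in> B"
  then have "dist_to_set z (A k) = 0" for k using assms(2) by (blast intro: dist_to_set_eq_0)
  then show "z \<in> inner_limit S A"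
    using z assms(1) by (auto simp: inner_limit_def Limsup_const)
qed

text \<open>The indices \<open>r\<close> tend to infinity but may repeat; this is enough to compose
  with a convergent sequence such as \<open>e\<close>.\<close>

lemma outer_limit_sequence:
  assumes "z \<in> outer_limit S A"
  obtains r y where "filterlim r at_top sequentially" "\<And>n. y n \<in> A (r n)" "y \<longlonglongrightarrow> z"
proof -
  have lim: "liminf (\<lambda>k. dist_to_set z (A k)) = 0"
    using assms by (simp add: outer_limit_def)
  have "\<exists>k y. n \<le> k \<and> y \<in> A k \<and> dist z y < inverse (real (Suc n))" for n
  proof -
    have "\<not> ereal (inverse (real (Suc n))) \<le> liminf (\<lambda>k. dist_to_set z (A k))"
      using lim by (simp del: of_nat_Suc)
    then have "\<not> (\<forall>\<^sub>F k in sequentially. ereal (inverse (real (Suc n))) \<le> dist_to_set z (A k))"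
      by (rule contrapos_nn) (rule Liminf_bounded)
    then obtain k where "n \<le> k" "dist_to_set z (A k) < ereal (inverse (real (Suc n)))"
      by (auto simp: eventually_sequentially not_le)
    \<comment> \<open>An infimum below a real number is undercut by some element, so a point of
      \<open>A k\<close> is obtained along with the bound; an empty \<open>A k\<close> would have
      distance \<infinity>.\<close>
    then show ?thesis by (auto simp: dist_to_set_def INF_less_iff)
  qed
  then obtain r y where r: "\<And>n. n \<le> r n" and y: "\<And>n. y n \<in> A (r n)"
    and d: "\<And>n. dist z (y n) < inverse (real (Suc n))"
    by metis
  have "filterlim r at_top sequentially"
    by (rule filterlim_at_top_mono[OF filterlim_ident]) (simp add: r)
  moreover have "y \<longlonglongrightarrow> z"
  proof (rule metric_tendsto_imp_tendsto[OF LIMSEQ_inverse_real_of_nat])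
    show "\<forall>\<^sub>F n in sequentially. dist (y n) z \<le> dist (inverse (real (Suc n))) 0"
      using d by (auto simp: dist_commute less_imp_le simp del: of_nat_Suc)
  qed
  ultimately show ?thesis using that y by blast
qed

section \<open>Epi-convergence of the perturbed functions\<close>

lemma epi_extend_inftyI:
  assumes "x \<in> D" "x \<in> E" "f x \<le> ereal \<alpha>"
  shows "(x, \<alpha>) \<in> epi E (extend_infty D f)"
  using assms by (simp add: epi_def extend_infty_def)

lemma epi_extend_inftyD:
  assumes "(x, \<alpha>) \<in> epi E (extend_infty D f)"
  shows "x \<in> D" "x \<in> E" "f x \<le> ereal \<alpha>"
  using assms by (auto simp: epi_def extend_infty_def split: if_splits)

lemma epi_converges_lambda_max_perturbed:
  assumes e: "\<And>k. 0 < e k" and e0: "e \<longlonglongrightarrow> 0"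
  shows "epi_converges (sym_mats \<times> sym_mats)
    (\<lambda>k. extend_infty (psd_mats \<times> psd_mats)
      (\<lambda>(X, Y). lambda_max X (Y + e k *\<^sub>R mat 1 :: real^'n^'n)))
    (extend_infty (psd_mats \<times> psd_mats) (\<lambda>(X, Y). lambda_max X Y))"
proof -
  let ?E = "sym_mats \<times> sym_mats :: ((real^'n^'n) \<times> (real^'n^'n)) set"
  let ?D = "psd_mats \<times> psd_mats :: ((real^'n^'n) \<times> (real^'n^'n)) set"
  let ?F = "\<lambda>k. extend_infty ?D (\<lambda>(X, Y). lambda_max X (Y + e k *\<^sub>R mat 1))"
  let ?f = "extend_infty ?D (\<lambda>(X, Y). lambda_max X Y)"
  have "epi ?E ?f \<subseteq> epi ?E (?F k)" for k
  proof clarify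
    fix X Y :: "real^'n^'n" and \<alpha>
    assume "((X, Y), \<alpha>) \<in> epi ?E ?f"
    note * = epi_extend_inftyD[OF this]
    have X: "X \<in> psd_mats" and Y: "Y \<in> psd_mats" and \<alpha>: "0 \<le> \<alpha>"
      and le: "\<And>v. v \<bullet> (X *v v) \<le> \<alpha> * (v \<bullet> (Y *v v))"
      using * by (auto simp: lambda_max_le_iff)
    \<comment> \<open>The same \<alpha> works: since it is nonnegative, the perturbation only
      enlarges the right side.\<close>
    have "v \<bullet> (X *v v) \<le> \<alpha> * (v \<bullet> (Y *v v) + e k * (v \<bullet> v))" for v
      using le[of v] \<alpha> e[of k] by (simp add: distrib_left add_increasing2)
    then have "lambda_max X (Y + e k *\<^sub>R mat 1) \<le> ereal \<alpha>"
      using \<alpha> e[of k] by (simp add: lambda_max_perturbed_le_iff[OF X Y])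
    then show "((X, Y), \<alpha>) \<in> epi ?E (?F k)"
      using * by (intro epi_extend_inftyI) auto
  qed
  then have inner: "epi ?E ?f \<subseteq> inner_limit (?E \<times> UNIV) (\<lambda>k. epi ?E (?F k))"
    by (intro subset_inner_limit) (auto simp: epi_def)
  have outer: "outer_limit (?E \<times> UNIV) (\<lambda>k. epi ?E (?F k)) \<subseteq> epi ?E ?f"
  proof
    fix z assume z: "z \<in> outer_limit (?E \<times> UNIV) (\<lambda>k. epi ?E (?F k))"
    then obtain r y where r: "filterlim r at_top sequentially"
      and y: "\<And>n. y n \<in> epi ?E (?F (r n))" and lim: "y \<longlonglongrightarrow> z"
      by (rule outer_limit_sequence) blast
    obtain X Y \<alpha> where z_eq: "z = ((X, Y), \<alpha>)" by (metis surj_pair)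
    define Xn where "Xn = (\<lambda>n. fst (fst (y n)))"
    define Yn where "Yn = (\<lambda>n. snd (fst (y n)))"
    define an where "an = (\<lambda>n. snd (y n))"
    have y_eq: "y n = ((Xn n, Yn n), an n)" for n by (simp add: Xn_def Yn_def an_def)
    have Xlim: "Xn \<longlonglongrightarrow> X"
      using tendsto_fst[OF tendsto_fst[OF lim]] by (simp add: z_eq Xn_def)
    have Ylim: "Yn \<longlonglongrightarrow> Y"
      using tendsto_snd[OF tendsto_fst[OF lim]] by (simp add: z_eq Yn_def)
    have alim: "an \<longlonglongrightarrow> \<alpha>"
      using tendsto_snd[OF lim] by (simp add: z_eq an_def)
    have elim: "(\<lambda>n. e (r n)) \<longlonglongrightarrow> 0" by (rule filterlim_compose[OF e0 r])
    note * = epi_extend_inftyD[OF y[unfolded y_eq]]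
    have Xn: "Xn n \<in> psd_mats" and Yn: "Yn n \<in> psd_mats" for n
      using *(1)[of n] by auto
    have "lambda_max (Xn n) (Yn n + e (r n) *\<^sub>R mat 1) \<le> ereal (an n)" for n
      using *(3)[of n] by simp
    then have an: "0 \<le> an n"
      and le: "v \<bullet> (Xn n *v v) \<le> an n * (v \<bullet> (Yn n *v v) + e (r n) * (v \<bullet> v))" for n v
      by (simp_all add: lambda_max_perturbed_le_iff[OF Xn Yn] e less_imp_le)
    \<comment> \<open>Symmetry of the limit matrices comes from the ambient set of the outer limit;
      nonnegativity of their forms is obtained by passing to the limit.\<close>
    have sym: "(X, Y) \<in> ?E" using z by (simp add: outer_limit_def z_eq)
    note form = tendsto_inner[OF tendsto_const tendsto_matrix_vector_mult]
    have X: "X \<in> psd_mats"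
      using sym LIMSEQ_le_const[OF form[OF Xlim]] psd_matsD(2)[OF Xn]
      by (auto simp: psd_mats_def)
    have Y: "Y \<in> psd_mats"
      using sym LIMSEQ_le_const[OF form[OF Ylim]] psd_matsD(2)[OF Yn]
      by (auto simp: psd_mats_def)
    have "0 \<le> \<alpha>" using LIMSEQ_le_const[OF alim] an by blast
    moreover have "v \<bullet> (X *v v) \<le> \<alpha> * (v \<bullet> (Y *v v))" for v
    proof -
      \<comment> \<open>In product form the inequality survives the limit even where
        \<open>v \<bullet> (Y *v v)\<close> vanishes and the quotient would break down.\<close>
      have "(\<lambda>n. an n * (v \<bullet> (Yn n *v v) + e (r n) * (v \<bullet> v)))
          \<longlonglongrightarrow> \<alpha> * (v \<bullet> (Y *v v) + 0 * (v \<bullet> v))"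
        by (intro tendsto_mult tendsto_add alim form Ylim elim tendsto_const)
      then show ?thesis using LIMSEQ_le[OF form[OF Xlim]] le by force
    qed
    ultimately have "lambda_max X Y \<le> ereal \<alpha>" by (simp add: lambda_max_le_iff X Y)
    then show "z \<in> epi ?E ?f"
      unfolding z_eq using X Y sym by (intro epi_extend_inftyI) auto
  qed
  show ?thesis
    unfolding epi_converges_def
    using inner outer inner_limit_subset_outer_limit by blast
qed

theorem theorem5:
  shows "(\<forall>\<epsilon>>0.
      (\<forall>X\<in>psd_mats. \<forall>Y\<in>psd_mats.
         \<bar>lambda_max X (Y + \<epsilon> *\<^sub>R mat 1 :: real^'n^'n)\<bar> \<noteq> \<infinity>) \<and>
      continuous_on (psd_mats \<times> psd_mats)
        (\<lambda>(X, Y). real_of_ereal (lambda_max X (Y + \<epsilon> *\<^sub>R mat 1 :: real^'n^'n)))) \<and>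
    (\<forall>X\<in>psd_mats. \<forall>Y\<in>psd_mats. lambda_max X (Y :: real^'n^'n) \<noteq> -\<infinity>) \<and>
    epi_converges_at_right_0 (sym_mats \<times> sym_mats)
      (\<lambda>\<epsilon>. extend_infty (psd_mats \<times> psd_mats)
              (\<lambda>(X, Y). lambda_max X (Y + \<epsilon> *\<^sub>R mat 1 :: real^'n^'n)))
      (extend_infty (psd_mats \<times> psd_mats) (\<lambda>(X, Y). lambda_max X Y))"
proof (intro conjI allI impI ballI)
  fix \<epsilon> :: real and X Y :: "real^'n^'n"
  assume "0 < \<epsilon>" "X \<in> psd_mats" "Y \<in> psd_mats"
  then show "\<bar>lambda_max X (Y + \<epsilon> *\<^sub>R mat 1)\<bar> \<noteq> \<infinity>"
    by (intro lambda_max_perturbed_finite)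
next
  fix X Y :: "real^'n^'n"
  assume "X \<in> psd_mats" "Y \<in> psd_mats"
  then show "lambda_max X Y \<noteq> -\<infinity>"
    using lambda_max_nonneg[of X Y] by auto
qed (simp_all add: continuous_on_lambda_max_perturbed epi_converges_at_right_0_def
    epi_converges_lambda_max_perturbed)

end
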